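(* Let $(X,d)$ be a metric space with at least two points and let $\mathcal{B}$ be a bornology on $X$ with a closed base. Then \begin{align*} w(C(X),\tau_{\mathcal{B}}^{sw})&=w_X(\mathcal{B})\cdot ib(C(X),\tau_{\mathcal{B}}^{sw})=w_X(\mathcal{B})\cdot c(C(X),\tau_{\mathcal{B}}^{sw})=w_X(\mathcal{B})\cdot L(C(X),\tau_{\mathcal{B}}^{sw})\\ &=w_X(\mathcal{B})\cdot d(C(X),\tau_{\mathcal{B}}^{sw})=w_X(\mathcal{B})\cdot nw(C(X),\tau_{\mathcal{B}}^{sw}). \end{align*}
   Context: A bornology on $X$ is a family $\mathcal{B}$ of nonempty subsets of $X$ that covers $X$ and is an ideal, i.e. is closed under finite unions and under passing to nonempty subsets. A base for $\mathcal{B}$ is a subfamily $\mathcal{B}_0\subseteq\mathcal{B}$ such that every $B\in\mathcal{B}$ is contained in some $B'\in\mathcal{B}_0$; $\mathcal{B}$ has a closed base if it has a base all of whose members are closed in $(X,d)$. The weight of $\mathcal{B}$ is $w_X(\mathcal{B})=\aleph_0+\min\{|\mathcal{B}_0| : \mathcal{B}_0 \text{ is a base for } \mathcal{B}\}$. $C(X)$ is the set of continuous functions $X\to\mathbb{R}$, and $C^+(X)$ the set of continuous functions $X\to(0,\infty)$. For $A\subseteq X$ nonempty and $\delta>0$, $A^\delta=\bigcup_{x\in A}\{y\in X: d(x,y)<\delta\}$. The topology $\tau_{\mathcal{B}}^{sw}$ of strong Whitney convergence on $\mathcal{B}$ is the topology on $C(X)$ induced by the uniformity having as a base the sets $[B,\epsilon]^{sw}=\{(f,g):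 \exists\,\delta>0\ \forall x\in B^\delta,\ |f(x)-g(x)|<\epsilon(x)\}$ with $B\in\mathcal{B}$, $\epsilon\in C^+(X)$. $C(X)$ with this topology is a topological group under pointwise addition. For a topological space $Y$: weight $w(Y)=\aleph_0+\min\{|\mathscr{B}|:\mathscr{B}\text{ is a base for }Y\}$; density $d(Y)=\aleph_0+\min\{|D|:D\text{ dense in }Y\}$; cellularity $c(Y)=\aleph_0+\sup\{|\mathscr{U}|:\mathscr{U}\text{ is a pairwise disjoint family of open subsets of }Y\}$; Lindelöf degree $L(Y)=\aleph_0+\min\{\mathfrak{m}:\text{every open cover of }Y\text{ has a subcover of cardinality}\le\mathfrak{m}\}$; a network on $Y$ is a collection $\mathscr{N}$ of nonempty subsets such that for each $y\in Y$ and open $U\ni y$ there is $C\in\mathscr{N}$ with $y\in C\subseteq U$; network weight $nw(Y)=\aleph_0+\min\{|\mathscr{N}|:\mathscr{N}\text{ is a network on }Y\}$. For an additive topological group $Y$ and an infinite cardinal $\lambda$, $Y$ is $\lambda$-narrow if for every neighborhood $U$ of the identity there is $S\subseteq Y$ with $|S|\le\lambda$ and $Y=U+S$; the index of narrowness is $ib(Y)=\aleph_0+\min\{\lambda: Y\text{ is }\lambda\text{-narrow}\}$. *)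

theory Defs
  imports "HOL-Analysis.Analysis" "HOL-Library.Function_Algebras"
begin

unbundle cardinal_syntax

section \<open>Cardinals attained as minima\<close>

text \<open>
  Cardinals are cardinal-order relations, compared across types by \<open>\<le>o\<close> and \<open>=o\<close>.
  The least cardinality of a member of a family is attained because cardinals are well-ordered;
  the choice of the member is immaterial up to \<open>=o\<close>.
\<close>

definition min_card :: "'b set set \<Rightarrow> 'b rel" where
  "min_card \<S> = (SOME r. \<exists>A\<in>\<S>. r = |A| \<and> (\<forall>B\<in>\<S>. |A| \<le>o |B| ))"

lemma min_card:
  assumes "\<S> \<noteq> {}"
  shows "\<exists>A\<in>\<S>. min_card \<S> = |A| \<and> (\<forall>B\<in>\<S>. |A| \<le>o |B| )"
proof -
  have "\<exists>r\<in>card_of ` \<S>. \<forall>r'\<in>card_of ` \<S>. r \<le>o r'"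
    by (rule exists_minim_Card_order) (use assms card_of_Card_order in auto)
  then have "\<exists>r. \<exists>A\<in>\<S>. r = |A| \<and> (\<forall>B\<in>\<S>. |A| \<le>o |B| )" by auto
  then show ?thesis unfolding min_card_def by (rule someI_ex)
qed

text \<open>
  The supremum of the cardinalities of the members of a family is the least upper bound. Every
  upper bound that is at most the cardinality of the type is the cardinality of a subset of the
  type, and the whole type is an upper bound.
\<close>

definition sup_card :: "'b set set \<Rightarrow> 'b rel" where
  "sup_card \<S> = min_card {A. \<forall>B\<in>\<S>. |B| \<le>o |A| }"

lemma sup_card_upper:
  fixes \<S> :: "'b set set"
  assumes "B \<in> \<S>"
  shows "|B| \<le>o sup_card \<S>"
proof -
  have "UNIV \<in> {A :: 'b set. \<forall>B\<in>\<S>. |B| \<le>o |A| }"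
    by (auto intro!: card_of_mono1)
  then have "{A :: 'b set. \<forall>B\<in>\<S>. |B| \<le>o |A| } \<noteq> {}" by blast
  from min_card[OF this] show ?thesis
    using assms unfolding sup_card_def by auto
qed

lemma sup_card_least:
  fixes r :: "'c rel" and \<S> :: "'b set set"
  assumes r: "Card_order r" and ub: "\<And>B. B \<in> \<S> \<Longrightarrow> |B| \<le>o r"
  shows "sup_card \<S> \<le>o r"
proof -
  let ?U = "{A :: 'b set. \<forall>B\<in>\<S>. |B| \<le>o |A| }"
  have "UNIV \<in> ?U" by (auto intro!: card_of_mono1)
  then have ne: "?U \<noteq> {}" by blast
  obtain M where M: "sup_card \<S> = |M|" "\<forall>A\<in>?U. |M| \<le>o |A|"
    using min_card[OF ne] unfolding sup_card_def by auto
  have rF: "|Field r| =o r" by (rule card_of_Field_ordIso[OF r])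
  show ?thesis
  proof (cases "|Field r| \<le>o |UNIV :: 'b set|")
    case True
    then obtain f where f: "inj_on f (Field r)" "f ` Field r \<subseteq> (UNIV :: 'b set)"
      using card_of_ordLeq[of "Field r" "UNIV :: 'b set"] by blast
    then have "|Field r| =o |f ` Field r|"
      using card_of_ordIso[of "Field r" "f ` Field r"] inj_on_imp_bij_betw by blast
    then have e: "|f ` Field r| =o r"
      using rF ordIso_symmetric ordIso_transitive by blast
    have "f ` Field r \<in> ?U"
      using ub e ordIso_symmetric ordLeq_ordIso_trans by blast
    then show ?thesis using M e ordLeq_ordIso_trans by fastforce
  next
    case False
    then have "|UNIV :: 'b set| \<le>o |Field r|"
      using ordLeq_total[OF card_of_Well_order card_of_Well_order] by blast
    then have "|M| \<le>o |Field r|"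
      using card_of_mono1[OF subset_UNIV] ordLeq_transitive by blast
    then show ?thesis using M rF ordLeq_ordIso_trans by fastforce
  qed
qed

section \<open>Cardinal functions of a topological space\<close>

definition is_topology_base :: "'a topology \<Rightarrow> 'a set set \<Rightarrow> bool" where
  "is_topology_base T \<N> \<longleftrightarrow>
     (\<forall>V\<in>\<N>. openin T V) \<and> (\<forall>U y. openin T U \<and> y \<in> U \<longrightarrow> (\<exists>V\<in>\<N>. y \<in> V \<and> V \<subseteq> U))"

definition top_weight :: "'a topology \<Rightarrow> (nat + 'a set) rel" where
  "top_weight T = natLeq +c min_card {\<N>. is_topology_base T \<N>}"

definition top_density :: "'a topology \<Rightarrow> (nat + 'a) rel" where
  "top_density T = natLeq +c min_card {D. D \<subseteq> topspace T \<and> T closure_of D = topspace T}"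

definition top_cellularity :: "'a topology \<Rightarrow> (nat + 'a set) rel" where
  "top_cellularity T =
     natLeq +c sup_card {\<U>. (\<forall>U\<in>\<U>. openin T U) \<and> pairwise disjnt \<U>}"

text \<open>
  In the Lindelof degree the cardinal \<open>\<mm>\<close> ranges over the cardinalities of families of
  sets of points; the family of all sets of points always qualifies, so no smaller cardinal is
  missed.
\<close>

definition lindelof_degree :: "'a topology \<Rightarrow> (nat + 'a set) rel" where
  "lindelof_degree T = natLeq +c min_card {\<M> :: 'a set set.
     \<forall>\<U>. (\<forall>U\<in>\<U>. openin T U) \<and> \<Union>\<U> = topspace T \<longrightarrow>
         (\<exists>\<V>\<subseteq>\<U>. \<Union>\<V> = topspace T \<and> |\<V>| \<le>o |\<M>| )}"

definition is_network :: "'a topology \<Rightarrow> 'a set set \<Rightarrow> bool" where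
  "is_network T \<N> \<longleftrightarrow>
     (\<forall>C\<in>\<N>. C \<noteq> {} \<and> C \<subseteq> topspace T) \<and>
     (\<forall>U y. openin T U \<and> y \<in> U \<longrightarrow> (\<exists>C\<in>\<N>. y \<in> C \<and> C \<subseteq> U))"

definition network_weight :: "'a topology \<Rightarrow> (nat + 'a set) rel" where
  "network_weight T = natLeq +c min_card {\<N>. is_network T \<N>}"

section \<open>Index of narrowness of an additive topological group\<close>

text \<open>
  The group is the subset \<open>topspace T\<close> of the ambient group type, and \<open>U + S\<close> is the
  Minkowski sum.
\<close>

definition narrow :: "'g::group_add topology \<Rightarrow> 'c rel \<Rightarrow> bool" where
  "narrow T r \<longleftrightarrow>
     (\<forall>U \<subseteq> topspace T. (\<exists>V. openin T V \<and> 0 \<in> V \<and> V \<subseteq> U) \<longrightarrow>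
        (\<exists>S \<subseteq> topspace T. |S| \<le>o r \<and> topspace T = U + S))"

text \<open>
  The infinite cardinal \<open>\<lambda>\<close> ranges over the cardinalities of infinite subsets of
  \<open>nat + 'g\<close>; the summand \<open>nat\<close> makes infinite cardinals available for finite
  groups too, and the whole of \<open>nat + 'g\<close> always qualifies.
\<close>

definition narrowness_index :: "'g::group_add topology \<Rightarrow> (nat + (nat + 'g)) rel" where
  "narrowness_index T = natLeq +c min_card {L. infinite L \<and> narrow T |L| }"

section \<open>Bornologies\<close>

definition bornology :: "'a set set \<Rightarrow> bool" where
  "bornology \<B> \<longleftrightarrow>
     {} \<notin> \<B> \<and> \<Union>\<B> = UNIV \<and>
     (\<forall>A\<in>\<B>. \<forall>B\<in>\<B>. A \<union> B \<in> \<B>) \<and>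
     (\<forall>A\<in>\<B>. \<forall>B. B \<subseteq> A \<and> B \<noteq> {} \<longrightarrow> B \<in> \<B>)"

definition bornology_base :: "'a set set \<Rightarrow> 'a set set \<Rightarrow> bool" where
  "bornology_base \<B> \<B>\<^sub>0 \<longleftrightarrow> \<B>\<^sub>0 \<subseteq> \<B> \<and> (\<forall>B\<in>\<B>. \<exists>B'\<in>\<B>\<^sub>0. B \<subseteq> B')"

definition has_closed_base :: "'a::metric_space set set \<Rightarrow> bool" where
  "has_closed_base \<B> \<longleftrightarrow> (\<exists>\<B>\<^sub>0. bornology_base \<B> \<B>\<^sub>0 \<and> (\<forall>B\<in>\<B>\<^sub>0. closed B))"

definition bornology_weight :: "'a set set \<Rightarrow> (nat + 'a set) rel" where
  "bornology_weight \<B> = natLeq +c min_card {\<B>\<^sub>0. bornology_base \<B> \<B>\<^sub>0}"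

section \<open>Strong Whitney convergence\<close>

definition cont_funs :: "('a::metric_space \<Rightarrow> real) set" where
  "cont_funs = {f. continuous_on UNIV f}"

definition pos_cont_funs :: "('a::metric_space \<Rightarrow> real) set" where
  "pos_cont_funs = {f. continuous_on UNIV f \<and> (\<forall>x. 0 < f x)}"

definition enlargement :: "'a::metric_space set \<Rightarrow> real \<Rightarrow> 'a set" where
  "enlargement A \<delta> = (\<Union>x\<in>A. {y. dist x y < \<delta>})"

definition sw_entourage ::
    "'a::metric_space set \<Rightarrow> ('a \<Rightarrow> real) \<Rightarrow> (('a \<Rightarrow> real) \<times> ('a \<Rightarrow> real)) set" where
  "sw_entourage B \<epsilon> = {(f, g). f \<in> cont_funs \<and> g \<in> cont_funs \<and>
     (\<exists>\<delta>>0. \<forall>x\<in>enlargement B \<delta>. \<bar>f x - g x\<bar> < \<epsilon> x)}"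

definition sw_uniformity ::
    "'a::metric_space set set \<Rightarrow> (('a \<Rightarrow> real) \<times> ('a \<Rightarrow> real)) set set" where
  "sw_uniformity \<B> = {E. E \<subseteq> cont_funs \<times> cont_funs \<and>
     (\<exists>B\<in>\<B>. \<exists>\<epsilon>\<in>pos_cont_funs. sw_entourage B \<epsilon> \<subseteq> E)}"

definition sw_topology :: "'a::metric_space set set \<Rightarrow> ('a \<Rightarrow> real) topology" where
  "sw_topology \<B> = topology (\<lambda>U. U \<subseteq> cont_funs \<and>
     (\<forall>f\<in>U. \<exists>E\<in>sw_uniformity \<B>. E `` {f} \<subseteq> U))"

lemma sw_uniformity_Int:
  assumes "bornology \<B>" "E \<in> sw_uniformity \<B>" "F \<in> sw_uniformity \<B>"
  shows "E \<inter> F \<in> sw_uniformity \<B>"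
proof -
  obtain A \<alpha> where A: "A \<in> \<B>" "\<alpha> \<in> pos_cont_funs" "sw_entourage A \<alpha> \<subseteq> E"
    using assms unfolding sw_uniformity_def by blast
  obtain B \<beta> where B: "B \<in> \<B>" "\<beta> \<in> pos_cont_funs" "sw_entourage B \<beta> \<subseteq> F"
    using assms unfolding sw_uniformity_def by blast
  let ?m = "\<lambda>x. min (\<alpha> x) (\<beta> x)"
  have "?m \<in> pos_cont_funs"
    using A B by (auto simp: pos_cont_funs_def intro: continuous_on_min)
  moreover have "A \<union> B \<in> \<B>" using A B assms(1) by (auto simp: bornology_def)
  moreover have "sw_entourage (A \<union> B) ?m \<subseteq> sw_entourage A \<alpha> \<inter> sw_entourage B \<beta>"
  proof (rule subrelI)
    fix f g assume "(f, g) \<in> sw_entourage (A \<union> B) ?m"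
    then obtain \<delta> where "f \<in> cont_funs" "g \<in> cont_funs" "\<delta> > 0"
      and \<delta>: "\<forall>x\<in>enlargement (A \<union> B) \<delta>. \<bar>f x - g x\<bar> < ?m x"
      unfolding sw_entourage_def by blast
    moreover have "\<forall>x\<in>enlargement A \<delta>. \<bar>f x - g x\<bar> < \<alpha> x"
      and "\<forall>x\<in>enlargement B \<delta>. \<bar>f x - g x\<bar> < \<beta> x"
      using \<delta> by (simp_all add: enlargement_def)
    ultimately show "(f, g) \<in> sw_entourage A \<alpha> \<inter> sw_entourage B \<beta>"
      unfolding sw_entourage_def by blast
  qed
  ultimately show ?thesis
    using A B assms(2) unfolding sw_uniformity_def by blast
qed

lemma openin_sw_topology:
  assumes "bornology \<B>"
  shows "openin (sw_topology \<B>) U \<longleftrightarrow>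
    U \<subseteq> cont_funs \<and> (\<forall>f\<in>U. \<exists>E\<in>sw_uniformity \<B>. E `` {f} \<subseteq> U)"
proof -
  have "istopology (\<lambda>U. U \<subseteq> cont_funs \<and> (\<forall>f\<in>U. \<exists>E\<in>sw_uniformity \<B>. E `` {f} \<subseteq> U))"
    unfolding istopology_def
  proof (intro conjI allI impI ballI)
    fix S T f
    assume S: "S \<subseteq> cont_funs \<and> (\<forall>f\<in>S. \<exists>E\<in>sw_uniformity \<B>. E `` {f} \<subseteq> S)"
      and T: "T \<subseteq> cont_funs \<and> (\<forall>f\<in>T. \<exists>E\<in>sw_uniformity \<B>. E `` {f} \<subseteq> T)"
      and f: "f \<in> S \<inter> T"
    then obtain E F where "E \<in> sw_uniformity \<B>" "F \<in> sw_uniformity \<B>"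
      "E `` {f} \<subseteq> S" "F `` {f} \<subseteq> T" by blast
    then show "\<exists>E\<in>sw_uniformity \<B>. E `` {f} \<subseteq> S \<inter> T"
      using sw_uniformity_Int[OF assms] by (intro bexI[of _ "E \<inter> F"]) auto
  next
    fix \<K> f
    assume "\<forall>K\<in>\<K>. K \<subseteq> cont_funs \<and> (\<forall>f\<in>K. \<exists>E\<in>sw_uniformity \<B>. E `` {f} \<subseteq> K)"
      and "f \<in> \<Union>\<K>"
    then show "\<exists>E\<in>sw_uniformity \<B>. E `` {f} \<subseteq> \<Union>\<K>" by (meson Sup_upper UnionE order_trans)
  qed blast+
  then show ?thesis unfolding sw_topology_def by (simp add: topology_inverse')
qed

lemma topspace_sw_topology:
  assumes "bornology \<B>"
  shows "topspace (sw_topology \<B>) = cont_funs"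
proof -
  obtain B where "B \<in> \<B>" using assms by (auto simp: bornology_def)
  moreover have "(\<lambda>x. 1) \<in> pos_cont_funs" by (simp add: pos_cont_funs_def)
  moreover have sub: "sw_entourage B e \<subseteq> cont_funs \<times> cont_funs" for B :: "'a set" and e
    by (auto simp: sw_entourage_def)
  ultimately have "\<exists>E. E \<in> sw_uniformity \<B>"
    unfolding sw_uniformity_def by blast
  moreover have "E `` {f} \<subseteq> cont_funs" if "E \<in> sw_uniformity \<B>" for E f
    using that unfolding sw_uniformity_def by auto
  ultimately have "openin (sw_topology \<B>) cont_funs"
    unfolding openin_sw_topology[OF assms] by (meson order_refl)
  then have "cont_funs \<subseteq> topspace (sw_topology \<B>)" by (rule openin_subset)
  moreover have "topspace (sw_topology \<B>) \<subseteq> cont_funs"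
    using openin_sw_topology[OF assms, of "topspace (sw_topology \<B>)"] by simp
  ultimately show ?thesis by simp
qed

end

theory Submission
  imports Defs
begin

text \<open>
  Write \<open>w\<close>, \<open>nw\<close>, \<open>d\<close>, \<open>c\<close>, \<open>L\<close>, \<open>ib\<close> for the cardinal functions of the space of continuous
  functions with the strong Whitney topology, and \<open>W\<close> for the weight of the bornology. All of them
  are infinite cardinals, so the product of two of them that are at most \<open>w\<close> is at most \<open>w\<close>. It
  therefore suffices to prove \<open>w \<le> W * ib\<close>, \<open>W \<le> w\<close>, and \<open>ib \<le> k \<le> w\<close> for each of the cardinals \<open>k\<close>
  in the theorem; then every \<open>W * k\<close> is squeezed between \<open>W * ib\<close> and \<open>w * w = w\<close>
  (\<open>cprod_squeeze\<close>).

  The bounds \<open>d \<le> nw \<le> w\<close>, \<open>c \<le> w\<close> and \<open>L \<le> w\<close> hold in every topological space. The bounds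
  \<open>ib \<le> c, L, d\<close> are the usual ones for topological groups. They become transparent once narrowness
  is read off the uniformity: the group is \<open>r\<close>-narrow iff every entourage has an \<open>r\<close>-sized set of
  centres whose balls cover the space (\<open>narrow_sw_topology_iff\<close>).

  For \<open>W \<le> w\<close> (\<open>bornology_weight_le_weight\<close>), a neighbourhood base at \<open>0\<close> determines closed members
  \<open>B\<close> of the bornology by \<open>[B, \<epsilon>](0) \<subseteq> N\<close>. They form a base of the bornology, because a point outside
  a closed \<open>B\<close> carries a continuous function that is large there and vanishes near \<open>B\<close>.

  The heart is \<open>w \<le> W * ib\<close> (\<open>weight_le_bornology_weight_narrowness_index\<close>). A priori the local base
  at \<open>0\<close> involves all positive continuous functions \<open>\<epsilon>\<close>, which may be far more numerous than
  \<open>W * ib\<close>. Narrowness thins them out. Given \<open>B\<close>, choose \<open>ib\<close> many continuous \<open>s\<close> whose balls for the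
  entourage \<open>[B, 1]\<close> cover the space. For a given \<open>\<epsilon>\<close> one of them satisfies \<open>\<bar>s - 1/\<epsilon>\<bar> < 1\<close> near \<open>B\<close>,
  whence \<open>1/(\<bar>s\<bar> + 1) < \<epsilon>\<close> near \<open>B\<close>. So \<open>W * ib\<close> many entourages suffice, and for each of them
  \<open>ib\<close> many translates of its ball at \<open>0\<close> cover the space; all these translates form a base.
\<close>

section \<open>Arithmetic of the cardinal functions\<close>

lemma Cinfinite_natLeq_csum: "Cinfinite (natLeq +c r)"
  by (simp add: Cinfinite_csum1 natLeq_Cinfinite)

lemma natLeq_csum_min_card_le:
  assumes "A \<in> \<S>" "|A| \<le>o r" "Cinfinite r"
  shows "natLeq +c min_card \<S> \<le>o r"
proof -
  obtain M where M: "min_card \<S> = |M|" "|M| \<le>o |A|"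
    using min_card[of \<S>] assms(1) by blast
  then have "min_card \<S> \<le>o r" using assms(2) ordLeq_transitive by metis
  moreover have "Card_order (min_card \<S>)" using M(1) by (simp add: card_of_Card_order)
  ultimately show ?thesis
    using csum_cinfinite_bound[OF natLeq_ordLeq_cinfinite[OF assms(3)] _ natLeq_Card_order _ assms(3)]
    by blast
qed

lemma min_card_attained:
  assumes "\<S> \<noteq> {}"
  shows "\<exists>A\<in>\<S>. |A| \<le>o natLeq +c min_card \<S>"
proof -
  obtain A where A: "A \<in> \<S>" "min_card \<S> = |A|" using min_card[OF assms] by blast
  have "|A| \<le>o natLeq +c |A|" by (rule ordLeq_csum2) (rule card_of_Card_order)
  then show ?thesis using A by auto
qed

text \<open>
  The family behind the supremum contains the whole type, so its minimum is attained and is the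
  cardinality of a set.
\<close>

lemma Card_order_sup_card:
  fixes \<S> :: "'a set set"
  shows "Card_order (sup_card \<S>)"
proof -
  have "UNIV \<in> {A :: 'a set. \<forall>B\<in>\<S>. |B| \<le>o |A| }" using card_of_mono1[OF subset_UNIV] by blast
  then have "{A :: 'a set. \<forall>B\<in>\<S>. |B| \<le>o |A| } \<noteq> {}" by blast
  from min_card[OF this] show ?thesis unfolding sup_card_def by (auto simp: card_of_Card_order)
qed

text \<open>
  The common pattern of all the equalities: \<open>r \<le> p * i \<le> p * k \<le> r * r = r\<close>.
\<close>

lemma cprod_squeeze:
  fixes r :: "'a rel" and p :: "'b rel" and k :: "'c rel" and i :: "'d rel"
  assumes "Cinfinite r" and "r \<le>o p *c i" "p \<le>o r" "i \<le>o k" "k \<le>o r"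
  shows "p *c k =o r"
proof -
  have "p *c k \<le>o r *c r" using assms by (intro cprod_mono)
  then have "p *c k \<le>o r" using cprod_infinite[OF assms(1)] ordLeq_ordIso_trans by blast
  moreover have "p *c i \<le>o p *c k" using assms(4) by (rule cprod_mono2)
  ultimately show ?thesis using assms(2) ordLeq_transitive ordIso_iff_ordLeq by blast
qed

section \<open>Inequalities valid in every topological space\<close>

lemma obtain_topology_base:
  obtains \<N> where "is_topology_base T \<N>" "|\<N>| \<le>o top_weight T"
proof -
  have "is_topology_base T {U. openin T U}" unfolding is_topology_base_def by blast
  then have "{\<N>. is_topology_base T \<N>} \<noteq> {}" by blast
  from min_card_attained[OF this] that show ?thesis unfolding top_weight_def by blast
qed

text \<open>Up to the empty set, which a network may not contain, a base is a network.\<close>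

lemma network_weight_le_weight: "network_weight T \<le>o top_weight T"
proof -
  obtain \<N> where \<N>: "is_topology_base T \<N>" "|\<N>| \<le>o top_weight T"
    by (rule obtain_topology_base)
  have "is_network T (\<N> - {{}})"
    unfolding is_network_def
  proof (intro conjI ballI allI impI)
    fix C assume "C \<in> \<N> - {{}}"
    then show "C \<noteq> {}" "C \<subseteq> topspace T"
      using \<N>(1) openin_subset unfolding is_topology_base_def by blast+
  next
    fix U y assume "openin T U \<and> y \<in> U"
    then show "\<exists>C\<in>\<N> - {{}}. y \<in> C \<and> C \<subseteq> U"
      using \<N>(1) unfolding is_topology_base_def by blast
  qed
  moreover have "|\<N> - {{}}| \<le>o top_weight T"
    by (rule ordLeq_transitive[OF card_of_mono1 \<N>(2)]) blast
  moreover have "Cinfinite (top_weight T)" unfolding top_weight_def by (rule Cinfinite_natLeq_csum)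
  ultimately show ?thesis
    unfolding network_weight_def by (intro natLeq_csum_min_card_le[of "\<N> - {{}}"]) auto
qed

text \<open>One point from each member of a network gives a dense set.\<close>

lemma density_le_network_weight:
  fixes T :: "'a topology"
  shows "top_density T \<le>o network_weight T"
proof -
  have "is_network T {{y} | y. y \<in> topspace T}"
    unfolding is_network_def
  proof (intro conjI allI impI ballI)
    fix U y assume Uy: "openin T U \<and> y \<in> U"
    then have "y \<in> topspace T" using openin_subset by blast
    then show "\<exists>C\<in>{{y} |y. y \<in> topspace T}. y \<in> C \<and> C \<subseteq> U" using Uy by blast
  qed auto
  then have "{\<N>. is_network T \<N>} \<noteq> {}" by blast
  from min_card_attained[OF this] obtain \<N> where
    \<N>: "is_network T \<N>" "|\<N>| \<le>o network_weight T"
    unfolding network_weight_def by blast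
  have ne: "C \<noteq> {}" "C \<subseteq> topspace T" if "C \<in> \<N>" for C
    using \<N>(1) that unfolding is_network_def by simp_all
  define p where "p C = (SOME y. y \<in> C)" for C :: "'a set"
  have p: "p C \<in> C" if "C \<in> \<N>" for C
    unfolding p_def using ne(1)[OF that] by (rule some_in_eq[THEN iffD2])
  then have sub: "p ` \<N> \<subseteq> topspace T" using ne(2) by auto
  moreover have "T closure_of (p ` \<N>) = topspace T"
    unfolding dense_intersects_open
  proof (intro allI impI)
    fix U assume "openin T U \<and> U \<noteq> {}"
    then obtain y where "openin T U" "y \<in> U" by blast
    then obtain C where "C \<in> \<N>" "C \<subseteq> U"
      using \<N>(1)[unfolded is_network_def, THEN conjunct2, rule_format, of U y] by blast
    then show "p ` \<N> \<inter> U \<noteq> {}" using p by blast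
  qed
  moreover have "|p ` \<N>| \<le>o network_weight T"
    by (rule ordLeq_transitive[OF card_of_image \<N>(2)])
  moreover have "Cinfinite (network_weight T)"
    unfolding network_weight_def by (rule Cinfinite_natLeq_csum)
  ultimately show ?thesis
    unfolding top_density_def by (intro natLeq_csum_min_card_le[of "p ` \<N>"]) auto
qed

text \<open>
  The basic sets that lie inside some member of a cover still cover the space; one member of
  the cover for each of them gives a subcover.
\<close>

lemma lindelof_degree_le_weight: "lindelof_degree T \<le>o top_weight T"
proof -
  obtain \<N> where \<N>: "is_topology_base T \<N>" "|\<N>| \<le>o top_weight T"
    by (rule obtain_topology_base)
  have "\<exists>\<V>\<subseteq>\<U>. \<Union>\<V> = topspace T \<and> |\<V>| \<le>o |\<N>|"
    if \<U>: "\<forall>U\<in>\<U>. openin T U" "\<Union>\<U> = topspace T" for \<U>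
  proof -
    define \<N>' where "\<N>' = {N \<in> \<N>. \<exists>U\<in>\<U>. N \<subseteq> U}"
    have "\<forall>N\<in>\<N>'. \<exists>U. U \<in> \<U> \<and> N \<subseteq> U" unfolding \<N>'_def by blast
    from bchoice[OF this] obtain u where u: "\<And>N. N \<in> \<N>' \<Longrightarrow> u N \<in> \<U> \<and> N \<subseteq> u N"
      by blast
    have "topspace T \<subseteq> \<Union>(u ` \<N>')"
    proof
      fix y assume "y \<in> topspace T"
      then obtain U where "U \<in> \<U>" "openin T U" "y \<in> U" using \<U> by blast
      then obtain N where "N \<in> \<N>'" "y \<in> N"
        using \<N>(1) unfolding is_topology_base_def \<N>'_def by blast
      then show "y \<in> \<Union>(u ` \<N>')" using u by blast
    qed
    moreover have "u ` \<N>' \<subseteq> \<U>" using u by blast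
    moreover have "|u ` \<N>'| \<le>o |\<N>|"
      using card_of_image[of u \<N>'] card_of_mono1[of \<N>' \<N>] ordLeq_transitive
      unfolding \<N>'_def by blast
    ultimately show ?thesis using \<U>(2) by (intro exI[of _ "u ` \<N>'"]) blast
  qed
  moreover have "Cinfinite (top_weight T)" unfolding top_weight_def by (rule Cinfinite_natLeq_csum)
  ultimately show ?thesis
    unfolding lindelof_degree_def using \<N>(2) by (intro natLeq_csum_min_card_le[of \<N>]) auto
qed

text \<open>
  Disjoint nonempty open sets contain distinct nonempty basic sets. A disjoint family may also
  contain the empty set; it is sent to the empty set, hence the one extra element.
\<close>

lemma cellularity_le_weight:
  fixes T :: "'a topology"
  shows "top_cellularity T \<le>o top_weight T"
proof -
  obtain \<N> where \<N>: "is_topology_base T \<N>" "|\<N>| \<le>o top_weight T"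
    by (rule obtain_topology_base)
  have inf: "Cinfinite (top_weight T)" unfolding top_weight_def by (rule Cinfinite_natLeq_csum)
  let ?D = "{\<U>. (\<forall>U\<in>\<U>. openin T U) \<and> pairwise disjnt \<U>}"
  have "|\<U>| \<le>o top_weight T" if \<U>: "\<U> \<in> ?D" for \<U>
  proof -
    have "\<exists>N. N \<in> insert {} \<N> \<and> N \<subseteq> U \<and> (N = {} \<longrightarrow> U = {})" if "U \<in> \<U>" for U
    proof (cases "U = {}")
      case False
      then obtain y where "y \<in> U" by blast
      moreover have "openin T U" using \<U> that by blast
      ultimately show ?thesis using \<N>(1) unfolding is_topology_base_def by blast
    qed blast
    then obtain n where
      n: "\<And>U. U \<in> \<U> \<Longrightarrow> n U \<in> insert {} \<N> \<and> n U \<subseteq> U \<and> (n U = {} \<longrightarrow> U = {})"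
      by metis
    have "inj_on n \<U>"
    proof (rule inj_onI, rule ccontr)
      fix U V assume UV: "U \<in> \<U>" "V \<in> \<U>" "n U = n V" "U \<noteq> V"
      then have "U \<inter> V = {}" using \<U> unfolding pairwise_def disjnt_def by blast
      then show False using UV n[OF UV(1)] n[OF UV(2)] by auto
    qed
    then have "|\<U>| \<le>o |{{}} \<union> \<N>|" using n by (intro card_of_ordLeqI[of n]) auto
    moreover have "|{{}} \<union> \<N>| \<le>o top_weight T"
    proof (rule Un_Cinfinite_bound[OF _ \<N>(2) inf])
      have "|{{}} :: 'a set set| \<le>o |{0 :: nat}|" by (intro card_of_ordLeqI[of "\<lambda>_. 0"]) auto
      also have "|{0 :: nat}| \<le>o |UNIV :: nat set|" by (rule card_of_mono1) simp
      also have "|UNIV :: nat set| \<le>o natLeq" using card_of_nat ordIso_iff_ordLeq by blast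
      also have "natLeq \<le>o top_weight T" by (rule natLeq_ordLeq_cinfinite[OF inf])
      finally show "|{{}} :: 'a set set| \<le>o top_weight T" .
    qed
    ultimately show ?thesis using ordLeq_transitive by blast
  qed
  then have "sup_card ?D \<le>o top_weight T" using inf by (intro sup_card_least) auto
  then show ?thesis
    unfolding top_cellularity_def
    using csum_cinfinite_bound[OF natLeq_ordLeq_cinfinite[OF inf] _ natLeq_Card_order
        Card_order_sup_card inf]
    by blast
qed

section \<open>Strong Whitney entourages\<close>

text \<open>
  Unlike membership in an enlargement, the distance to \<open>B\<close> is a continuous function, from which
  new elements of the function space can be built.
\<close>

lemma enlargement_eq_infdist:
  assumes "B \<noteq> {}"
  shows "enlargement B \<delta> = {y. infdist y B < \<delta>}"
proof -
  have "infdist y B < \<delta> \<longleftrightarrow> (\<exists>x\<in>B. dist x y < \<delta>)" for y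
    using assms by (subst dist_commute) (auto simp: infdist_def cINF_less_iff)
  then show ?thesis unfolding enlargement_def by auto
qed

lemma sw_entourage_refl:
  assumes "f \<in> cont_funs" "\<epsilon> \<in> pos_cont_funs"
  shows "(f, f) \<in> sw_entourage B \<epsilon>"
proof -
  have "\<forall>x\<in>enlargement B 1. \<bar>f x - f x\<bar> < \<epsilon> x" using assms(2) unfolding pos_cont_funs_def by simp
  moreover have "(0::real) < 1" by simp
  ultimately show ?thesis using assms(1) unfolding sw_entourage_def by blast
qed

lemma sw_entourage_sym: "(f, g) \<in> sw_entourage B \<epsilon> \<Longrightarrow> (g, f) \<in> sw_entourage B \<epsilon>"
  unfolding sw_entourage_def by (simp add: abs_minus_commute)

lemma sw_entourage_trans:
  assumes "(f, g) \<in> sw_entourage B \<alpha>" "(g, h) \<in> sw_entourage B \<beta>"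
    and "\<And>x. \<alpha> x + \<beta> x \<le> \<epsilon> x"
  shows "(f, h) \<in> sw_entourage B \<epsilon>"
proof -
  obtain \<delta> \<eta> where d: "\<delta> > 0" "\<forall>x\<in>enlargement B \<delta>. \<bar>f x - g x\<bar> < \<alpha> x"
      and e: "\<eta> > 0" "\<forall>x\<in>enlargement B \<eta>. \<bar>g x - h x\<bar> < \<beta> x"
    using assms unfolding sw_entourage_def by blast
  have "\<bar>f x - h x\<bar> < \<epsilon> x" if "x \<in> enlargement B (min \<delta> \<eta>)" for x
  proof -
    have "x \<in> enlargement B \<delta>" "x \<in> enlargement B \<eta>"
      using that unfolding enlargement_def by auto
    then have "\<bar>f x - g x\<bar> < \<alpha> x" "\<bar>g x - h x\<bar> < \<beta> x" using d e by auto
    then show ?thesis using assms(3)[of x] by linarith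
  qed
  then show ?thesis
    using assms(1,2) d(1) e(1) unfolding sw_entourage_def
    by (auto intro!: exI[of _ "min \<delta> \<eta>"])
qed

lemma sw_entourage_mono:
  assumes "A \<subseteq> B" shows "sw_entourage B \<epsilon> \<subseteq> sw_entourage A \<epsilon>"
proof -
  have "enlargement A \<delta> \<subseteq> enlargement B \<delta>" for \<delta> using assms unfolding enlargement_def by auto
  then show ?thesis unfolding sw_entourage_def by blast
qed

text \<open>
  Entourages are translation invariant: the ball around \<open>f\<close> is the translate by \<open>f\<close> of the ball
  around \<open>0\<close>.
\<close>

lemma sw_entourage_zero_iff:
  assumes "f \<in> cont_funs" "g \<in> cont_funs"
  shows "(0, g - f) \<in> sw_entourage B \<epsilon> \<longleftrightarrow> (f, g) \<in> sw_entourage B \<epsilon>"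
proof -
  have "0 \<in> cont_funs" "g - f \<in> cont_funs"
    using assms unfolding cont_funs_def
    by (auto simp: zero_fun_def fun_diff_def intro!: continuous_intros)
  then show ?thesis
    using assms unfolding sw_entourage_def
    by (auto simp: zero_fun_def fun_diff_def abs_minus_commute)
qed

lemma half_pos_cont_funs: "\<epsilon> \<in> pos_cont_funs \<Longrightarrow> (\<lambda>x. \<epsilon> x / 2) \<in> pos_cont_funs"
  unfolding pos_cont_funs_def by (auto intro!: continuous_intros)

lemma openin_sw_topology_iff:
  assumes "bornology \<B>"
  shows "openin (sw_topology \<B>) U \<longleftrightarrow> U \<subseteq> cont_funs \<and>
    (\<forall>f\<in>U. \<exists>B\<in>\<B>. \<exists>\<epsilon>\<in>pos_cont_funs. sw_entourage B \<epsilon> `` {f} \<subseteq> U)"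
proof -
  have ent: "sw_entourage B \<epsilon> \<in> sw_uniformity \<B>" if "B \<in> \<B>" "\<epsilon> \<in> pos_cont_funs" for B \<epsilon>
    using that unfolding sw_uniformity_def by (auto simp: sw_entourage_def)
  have "(\<exists>E\<in>sw_uniformity \<B>. E `` {f} \<subseteq> U) \<longleftrightarrow>
      (\<exists>B\<in>\<B>. \<exists>\<epsilon>\<in>pos_cont_funs. sw_entourage B \<epsilon> `` {f} \<subseteq> U)" for f
  proof
    assume "\<exists>E\<in>sw_uniformity \<B>. E `` {f} \<subseteq> U"
    then show "\<exists>B\<in>\<B>. \<exists>\<epsilon>\<in>pos_cont_funs. sw_entourage B \<epsilon> `` {f} \<subseteq> U"
      unfolding sw_uniformity_def by blast
  qed (use ent in blast)
  then show ?thesis unfolding openin_sw_topology[OF assms] by simp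
qed

text \<open>
  For \<open>g\<close> in the ball around \<open>f\<close>, the slack \<open>\<epsilon> - \<bar>f - g\<bar>\<close> is a suitable radius for a ball around
  \<open>g\<close>, but it is known to be positive only on an enlargement of \<open>B\<close>. Its maximum with a function
  that is positive far from \<open>B\<close> is positive everywhere and agrees with the slack close to \<open>B\<close>.
\<close>

lemma openin_sw_entourage_Image:
  assumes \<B>: "bornology \<B>" and B: "B \<in> \<B>" and \<epsilon>: "\<epsilon> \<in> pos_cont_funs"
  shows "openin (sw_topology \<B>) (sw_entourage B \<epsilon> `` {f})"
  unfolding openin_sw_topology_iff[OF \<B>]
proof (intro conjI ballI)
  show "sw_entourage B \<epsilon> `` {f} \<subseteq> cont_funs" unfolding sw_entourage_def by auto
next
  fix g assume "g \<in> sw_entourage B \<epsilon> `` {f}"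
  then obtain \<delta> where fg: "f \<in> cont_funs" "g \<in> cont_funs" and \<delta>: "\<delta> > 0"
      and lt: "\<forall>x\<in>enlargement B \<delta>. \<bar>f x - g x\<bar> < \<epsilon> x"
    unfolding sw_entourage_def by blast
  have "B \<noteq> {}" using \<B> B unfolding bornology_def by blast
  note enl = enlargement_eq_infdist[OF this]
  define \<eta> where "\<eta> x = max (\<epsilon> x - \<bar>f x - g x\<bar>) (infdist x B - \<delta> / 2)" for x
  have "0 < \<eta> x" for x
    using lt \<delta> unfolding enl \<eta>_def by (cases "infdist x B < \<delta>") auto
  moreover have "continuous_on UNIV \<eta>"
    using fg \<epsilon> unfolding \<eta>_def[abs_def] cont_funs_def pos_cont_funs_def
    by (auto intro!: continuous_intros)
  ultimately have \<eta>: "\<eta> \<in> pos_cont_funs" unfolding pos_cont_funs_def by blast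
  have "(f, h) \<in> sw_entourage B \<epsilon>" if gh: "(g, h) \<in> sw_entourage B \<eta>" for h
  proof -
    obtain \<rho> where h: "h \<in> cont_funs" and \<rho>: "\<rho> > 0"
      and lt': "\<forall>x\<in>enlargement B \<rho>. \<bar>g x - h x\<bar> < \<eta> x"
      using gh unfolding sw_entourage_def by blast
    have "\<bar>f x - h x\<bar> < \<epsilon> x" if "x \<in> enlargement B (min \<rho> (\<delta> / 2))" for x
    proof -
      have x: "infdist x B < \<rho>" "infdist x B < \<delta> / 2" using that unfolding enl by auto
      then have "\<bar>f x - g x\<bar> < \<epsilon> x" using lt \<delta> unfolding enl by simp
      then have "\<eta> x = \<epsilon> x - \<bar>f x - g x\<bar>" using x unfolding \<eta>_def by simp
      moreover have "\<bar>g x - h x\<bar> < \<eta> x" using lt' x unfolding enl by simp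
      ultimately show ?thesis by linarith
    qed
    then show ?thesis
      using fg h \<rho> \<delta> unfolding sw_entourage_def by (auto intro!: exI[of _ "min \<rho> (\<delta> / 2)"])
  qed
  then show "\<exists>B'\<in>\<B>. \<exists>\<epsilon>'\<in>pos_cont_funs. sw_entourage B' \<epsilon>' `` {g} \<subseteq> sw_entourage B \<epsilon> `` {f}"
    using B \<eta> by blast
qed

section \<open>Narrowness of the function space\<close>

text \<open>
  By translation invariance, covering the group by translates of a neighbourhood of \<open>0\<close> means
  covering the function space by balls of a fixed entourage.
\<close>

lemma narrow_sw_topology_iff:
  fixes \<B> :: "'a::metric_space set set"
  assumes \<B>: "bornology \<B>"
  shows "narrow (sw_topology \<B>) r \<longleftrightarrow>
    (\<forall>B\<in>\<B>. \<forall>\<epsilon>\<in>pos_cont_funs. \<exists>S\<subseteq>cont_funs. |S| \<le>o r \<and>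
       cont_funs \<subseteq> sw_entourage B \<epsilon> `` S)"
    (is "_ \<longleftrightarrow> ?R")
proof
  have zero: "0 \<in> cont_funs" unfolding cont_funs_def by (simp add: zero_fun_def)
  assume nar: "narrow (sw_topology \<B>) r"
  show ?R
  proof (intro ballI)
    fix B :: "'a set" and \<epsilon> :: "'a \<Rightarrow> real" assume B: "B \<in> \<B>" and \<epsilon>: "\<epsilon> \<in> pos_cont_funs"
    let ?U = "sw_entourage B \<epsilon> `` {0}"
    have U: "openin (sw_topology \<B>) ?U" by (rule openin_sw_entourage_Image[OF \<B> B \<epsilon>])
    have "0 \<in> ?U" using sw_entourage_refl[OF zero \<epsilon>] by blast
    then have "\<exists>V. openin (sw_topology \<B>) V \<and> 0 \<in> V \<and> V \<subseteq> ?U" using U by blast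
    from nar[unfolded narrow_def, rule_format, OF openin_subset[OF U] this]
    obtain S where S: "S \<subseteq> cont_funs" "|S| \<le>o r" "cont_funs = ?U + S"
      unfolding topspace_sw_topology[OF \<B>] by blast
    have "f \<in> sw_entourage B \<epsilon> `` S" if f: "f \<in> cont_funs" for f
    proof -
      obtain u s where us: "u \<in> ?U" "s \<in> S" "f = u + s"
        using f S(3) unfolding set_plus_def by blast
      then have "(0, f - s) \<in> sw_entourage B \<epsilon>" by simp
      then show ?thesis using sw_entourage_zero_iff[of s f] us S(1) f by blast
    qed
    then show "\<exists>S\<subseteq>cont_funs. |S| \<le>o r \<and> cont_funs \<subseteq> sw_entourage B \<epsilon> `` S" using S by blast
  qed
next
  assume R: ?R
  show "narrow (sw_topology \<B>) r"
    unfolding narrow_def topspace_sw_topology[OF \<B>]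
  proof (intro allI impI)
    fix U :: "('a \<Rightarrow> real) set"
    assume U: "U \<subseteq> cont_funs" and "\<exists>V. openin (sw_topology \<B>) V \<and> 0 \<in> V \<and> V \<subseteq> U"
    then obtain B \<epsilon> where B: "B \<in> \<B>" "\<epsilon> \<in> pos_cont_funs" "sw_entourage B \<epsilon> `` {0} \<subseteq> U"
      unfolding openin_sw_topology_iff[OF \<B>] by blast
    from R[rule_format, OF B(1,2)] obtain S where
      S: "S \<subseteq> cont_funs" "|S| \<le>o r" "cont_funs \<subseteq> sw_entourage B \<epsilon> `` S"
      by (elim exE conjE)
    have "f \<in> U + S" if f: "f \<in> cont_funs" for f
    proof -
      obtain s where s: "s \<in> S" "(s, f) \<in> sw_entourage B \<epsilon>" using S f by blast
      then have "f - s \<in> U" using sw_entourage_zero_iff[of s f] S(1) f B(3) by blast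
      then have "(f - s) + s \<in> U + S" using s(1) by (rule set_plus_intro)
      then show ?thesis by simp
    qed
    moreover have "U + S \<subseteq> cont_funs"
    proof
      fix f assume "f \<in> U + S"
      then obtain u s where "u \<in> cont_funs" "s \<in> cont_funs" "f = u + s"
        using U S(1) unfolding set_plus_def by blast
      then show "f \<in> cont_funs"
        unfolding cont_funs_def by (auto simp: plus_fun_def intro!: continuous_intros)
    qed
    ultimately show "\<exists>S\<subseteq>cont_funs. |S| \<le>o r \<and> cont_funs = U + S" using S by blast
  qed
qed

lemma narrow_sw_topology_cont_funs:
  assumes "bornology \<B>" "|cont_funs :: ('a::metric_space \<Rightarrow> real) set| \<le>o r"
  shows "narrow (sw_topology (\<B> :: 'a set set)) r"
  unfolding narrow_sw_topology_iff[OF assms(1)]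
proof (intro ballI exI conjI)
  fix B :: "'a set" and \<epsilon> :: "'a \<Rightarrow> real" assume "\<epsilon> \<in> pos_cont_funs"
  then show "cont_funs \<subseteq> sw_entourage B \<epsilon> `` cont_funs" using sw_entourage_refl by blast
qed (use assms(2) in auto)

lemma narrow_mono:
  assumes "narrow T r" "r \<le>o s"
  shows "narrow T s"
  unfolding narrow_def
proof (intro allI impI)
  fix U assume "U \<subseteq> topspace T" "\<exists>V. openin T V \<and> 0 \<in> V \<and> V \<subseteq> U"
  from assms(1)[unfolded narrow_def, rule_format, OF this]
  obtain S where "S \<subseteq> topspace T" "|S| \<le>o r" "topspace T = U + S" by blast
  then show "\<exists>S\<subseteq>topspace T. |S| \<le>o s \<and> topspace T = U + S"
    using assms(2) ordLeq_transitive by blast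
qed

text \<open>The minimum in the narrowness index is taken over a nonempty family.\<close>

lemma infinite_narrow_sw_topology_UNIV:
  fixes \<B> :: "'a::metric_space set set"
  assumes "bornology \<B>"
  shows "UNIV \<in> {L :: (nat + ('a \<Rightarrow> real)) set. infinite L \<and> narrow (sw_topology \<B>) |L| }"
proof -
  have "|cont_funs :: ('a \<Rightarrow> real) set| \<le>o |UNIV :: (nat + ('a \<Rightarrow> real)) set|"
    by (rule card_of_ordLeqI[of Inr]) auto
  moreover have "infinite (UNIV :: (nat + ('a \<Rightarrow> real)) set)" by (simp add: finite_Plus_UNIV_iff)
  ultimately show ?thesis using narrow_sw_topology_cont_funs[OF assms] by blast
qed

lemma narrow_narrowness_index:
  fixes \<B> :: "'a::metric_space set set"
  assumes "bornology \<B>"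
  shows "narrow (sw_topology \<B>) (narrowness_index (sw_topology \<B>))"
proof -
  have "{L :: (nat + ('a \<Rightarrow> real)) set. infinite L \<and> narrow (sw_topology \<B>) |L| } \<noteq> {}"
    using infinite_narrow_sw_topology_UNIV[OF assms] by blast
  from min_card_attained[OF this] obtain L :: "(nat + ('a \<Rightarrow> real)) set" where
    "narrow (sw_topology \<B>) |L|" "|L| \<le>o narrowness_index (sw_topology \<B>)"
    unfolding narrowness_index_def by blast
  then show ?thesis by (rule narrow_mono)
qed

text \<open>
  The index is a minimum over subsets of a fixed type, whereas \<open>r\<close> is a cardinal of any type:
  either \<open>r\<close> is the cardinality of a subset of that type, or it exceeds the whole type, which is
  itself a member of the family.
\<close>

lemma narrowness_index_le:
  fixes \<B> :: "'a::metric_space set set" and r :: "'c rel"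
  assumes \<B>: "bornology \<B>" and r: "Cinfinite r" and nar: "narrow (sw_topology \<B>) r"
  shows "narrowness_index (sw_topology \<B>) \<le>o r"
proof -
  let ?UN = "UNIV :: (nat + ('a \<Rightarrow> real)) set"
  have rF: "|Field r| =o r" using r card_of_Field_ordIso by blast
  consider "|Field r| \<le>o |?UN|" | "|?UN| \<le>o |Field r|"
    using ordLeq_total[OF card_of_Well_order card_of_Well_order] by blast
  then show ?thesis
  proof cases
    case 1
    then obtain h where h: "inj_on h (Field r)" "h ` Field r \<subseteq> ?UN"
      using card_of_ordLeq[of "Field r" ?UN] by blast
    then have "|Field r| =o |h ` Field r|"
      using card_of_ordIso[of "Field r" "h ` Field r"] inj_on_imp_bij_betw by blast
    then have e: "|h ` Field r| =o r" using rF ordIso_symmetric ordIso_transitive by blast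
    then have "narrow (sw_topology \<B>) |h ` Field r|"
      using nar narrow_mono ordIso_symmetric ordIso_imp_ordLeq by blast
    moreover have "infinite (h ` Field r)"
      using r h(1) unfolding cinfinite_def by (simp add: finite_image_iff)
    ultimately show ?thesis
      unfolding narrowness_index_def using e ordIso_imp_ordLeq r
      by (intro natLeq_csum_min_card_le[of "h ` Field r"]) auto
  next
    case 2
    then have "|?UN| \<le>o r" using rF ordLeq_ordIso_trans by blast
    then show ?thesis
      unfolding narrowness_index_def
      using infinite_narrow_sw_topology_UNIV[OF \<B>] r by (intro natLeq_csum_min_card_le[of ?UN])
  qed
qed

text \<open>A dense set meets every ball; by symmetry, the balls around its points cover the space.\<close>

lemma narrowness_index_le_density:
  fixes \<B> :: "'a::metric_space set set"
  assumes \<B>: "bornology \<B>"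
  shows "narrowness_index (sw_topology \<B>) \<le>o top_density (sw_topology \<B>)"
proof (rule narrowness_index_le[OF \<B>])
  let ?T = "sw_topology \<B>"
  show "Cinfinite (top_density ?T)" unfolding top_density_def by (rule Cinfinite_natLeq_csum)
  have "topspace ?T \<in> {D. D \<subseteq> topspace ?T \<and> ?T closure_of D = topspace ?T}" by simp
  then have "{D. D \<subseteq> topspace ?T \<and> ?T closure_of D = topspace ?T} \<noteq> {}" by blast
  from min_card_attained[OF this] obtain D where
    D: "D \<subseteq> topspace ?T" "?T closure_of D = topspace ?T" "|D| \<le>o top_density ?T"
    unfolding top_density_def by blast
  show "narrow ?T (top_density ?T)"
    unfolding narrow_sw_topology_iff[OF \<B>]
  proof (intro ballI exI conjI)
    show "D \<subseteq> cont_funs" using D(1) unfolding topspace_sw_topology[OF \<B>] .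
    show "|D| \<le>o top_density ?T" by (rule D(3))
    fix B :: "'a set" and \<epsilon> :: "'a \<Rightarrow> real" assume B: "B \<in> \<B>" "\<epsilon> \<in> pos_cont_funs"
    show "cont_funs \<subseteq> sw_entourage B \<epsilon> `` D"
    proof
      fix f :: "'a \<Rightarrow> real" assume "f \<in> cont_funs"
      then have "f \<in> sw_entourage B \<epsilon> `` {f}" using sw_entourage_refl B(2) by blast
      then have "D \<inter> sw_entourage B \<epsilon> `` {f} \<noteq> {}"
        using D(2) openin_sw_entourage_Image[OF \<B> B] unfolding dense_intersects_open by blast
      then show "f \<in> sw_entourage B \<epsilon> `` D" using sw_entourage_sym by blast
    qed
  qed
qed

text \<open>
  Take the cover by all balls of one entourage; the centres of the balls in a small subcover
  witness narrowness.
\<close>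

lemma narrowness_index_le_lindelof_degree:
  fixes \<B> :: "'a::metric_space set set"
  assumes \<B>: "bornology \<B>"
  shows "narrowness_index (sw_topology \<B>) \<le>o lindelof_degree (sw_topology \<B>)"
proof (rule narrowness_index_le[OF \<B>])
  let ?T = "sw_topology \<B>"
  let ?cov = "\<lambda>\<M> :: ('a \<Rightarrow> real) set set. \<forall>\<U>. (\<forall>U\<in>\<U>. openin ?T U) \<and> \<Union>\<U> = topspace ?T \<longrightarrow>
         (\<exists>\<V>\<subseteq>\<U>. \<Union>\<V> = topspace ?T \<and> |\<V>| \<le>o |\<M>| )"
  show "Cinfinite (lindelof_degree ?T)"
    unfolding lindelof_degree_def by (rule Cinfinite_natLeq_csum)
  have "?cov UNIV"
  proof (intro allI impI)
    fix \<U> assume "(\<forall>U\<in>\<U>. openin ?T U) \<and> \<Union>\<U> = topspace ?T"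
    then show "\<exists>\<V>\<subseteq>\<U>. \<Union>\<V> = topspace ?T \<and> |\<V>| \<le>o |UNIV :: ('a \<Rightarrow> real) set set|"
      using card_of_mono1[OF subset_UNIV] by (intro exI[of _ \<U>]) simp
  qed
  then have "UNIV \<in> Collect ?cov" by (rule CollectI)
  then have "Collect ?cov \<noteq> {}" by (metis empty_iff)
  from min_card_attained[OF this] obtain \<M> where
    "\<M> \<in> Collect ?cov" and \<M>_le: "|\<M>| \<le>o lindelof_degree ?T"
    unfolding lindelof_degree_def by (elim bexE)
  then have \<M>_cov: "?cov \<M>" by (simp only: mem_Collect_eq)
  show "narrow ?T (lindelof_degree ?T)"
    unfolding narrow_sw_topology_iff[OF \<B>]
  proof (intro ballI)
    fix B :: "'a set" and \<epsilon> :: "'a \<Rightarrow> real" assume B: "B \<in> \<B>" "\<epsilon> \<in> pos_cont_funs"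
    define \<U> where "\<U> = (\<lambda>f. sw_entourage B \<epsilon> `` {f}) ` cont_funs"
    have "\<forall>U\<in>\<U>. openin ?T U"
      unfolding \<U>_def using openin_sw_entourage_Image[OF \<B> B] by blast
    moreover have "\<Union>\<U> = topspace ?T"
    proof
      show "\<Union>\<U> \<subseteq> topspace ?T" using calculation openin_subset by blast
      show "topspace ?T \<subseteq> \<Union>\<U>"
        unfolding \<U>_def topspace_sw_topology[OF \<B>] using sw_entourage_refl[OF _ B(2)] by blast
    qed
    ultimately obtain \<V> where \<V>: "\<V> \<subseteq> \<U>" "\<Union>\<V> = topspace ?T" "|\<V>| \<le>o |\<M>|"
      using \<M>_cov[rule_format, of \<U>] by blast
    have "\<forall>V\<in>\<V>. \<exists>f. f \<in> cont_funs \<and> V = sw_entourage B \<epsilon> `` {f}"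
      using \<V>(1) unfolding \<U>_def by blast
    from bchoice[OF this] obtain c where
      c: "\<And>V. V \<in> \<V> \<Longrightarrow> c V \<in> cont_funs \<and> V = sw_entourage B \<epsilon> `` {c V}"
      by blast
    have "cont_funs \<subseteq> sw_entourage B \<epsilon> `` (c ` \<V>)"
      using \<V>(2) c unfolding topspace_sw_topology[OF \<B>] by blast
    moreover have "|c ` \<V>| \<le>o lindelof_degree ?T"
      by (rule ordLeq_transitive[OF card_of_image ordLeq_transitive[OF \<V>(3) \<M>_le]])
    ultimately show "\<exists>S\<subseteq>cont_funs. |S| \<le>o lindelof_degree ?T \<and> cont_funs \<subseteq> sw_entourage B \<epsilon> `` S"
      using c by (intro exI[of _ "c ` \<V>"]) blast
  qed
qed

text \<open>
  A maximal set \<open>S\<close> whose distinct points are not related by an entourage has the property that the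
  balls around \<open>S\<close> cover the space, while the balls of half the radius are pairwise disjoint, so that
  the cellularity bounds the size of \<open>S\<close>.
\<close>

lemma narrowness_index_le_cellularity:
  fixes \<B> :: "'a::metric_space set set"
  assumes \<B>: "bornology \<B>"
  shows "narrowness_index (sw_topology \<B>) \<le>o top_cellularity (sw_topology \<B>)"
proof (rule narrowness_index_le[OF \<B>])
  let ?T = "sw_topology \<B>"
  let ?D = "{\<U>. (\<forall>U\<in>\<U>. openin ?T U) \<and> pairwise disjnt \<U>}"
  show "Cinfinite (top_cellularity ?T)"
    unfolding top_cellularity_def by (rule Cinfinite_natLeq_csum)
  have cell: "|\<U>| \<le>o top_cellularity ?T" if "\<U> \<in> ?D" for \<U>
  proof -
    have le: "|\<U>| \<le>o sup_card ?D" by (rule sup_card_upper[OF that])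
    show ?thesis
      unfolding top_cellularity_def
      using le ordLeq_csum2[OF Card_order_sup_card] ordLeq_transitive by blast
  qed
  show "narrow ?T (top_cellularity ?T)"
    unfolding narrow_sw_topology_iff[OF \<B>]
  proof (intro ballI)
    fix B :: "'a set" and \<epsilon> :: "'a \<Rightarrow> real" assume B: "B \<in> \<B>" "\<epsilon> \<in> pos_cont_funs"
    let ?h = "\<lambda>x. \<epsilon> x / 2"
    \<comment> \<open>the \<open>\<epsilon>\<close>-separated sets\<close>
    define \<A> where "\<A> = {S. S \<subseteq> cont_funs \<and> (\<forall>s\<in>S. \<forall>t\<in>S. s \<noteq> t \<longrightarrow> (s, t) \<notin> sw_entourage B \<epsilon>)}"
    have "\<exists>S\<in>\<A>. \<forall>X\<in>\<A>. S \<subseteq> X \<longrightarrow> X = S"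
    proof (rule subset_Zorn')
      fix C assume C: "subset.chain \<A> C"
      have "(s, t) \<notin> sw_entourage B \<epsilon>" if st: "s \<in> \<Union>C" "t \<in> \<Union>C" "s \<noteq> t" for s t
      proof -
        obtain X where "X \<in> C" "s \<in> X" "t \<in> X"
          using C st unfolding subset_chain_def by blast
        then show ?thesis using C st(3) unfolding subset_chain_def \<A>_def by blast
      qed
      moreover have "\<Union>C \<subseteq> cont_funs" using C unfolding subset_chain_def \<A>_def by blast
      ultimately show "\<Union>C \<in> \<A>" unfolding \<A>_def by blast
    qed
    then obtain S where S: "S \<in> \<A>" and max: "\<And>X. X \<in> \<A> \<Longrightarrow> S \<subseteq> X \<Longrightarrow> X = S" by blast
    have Sc: "S \<subseteq> cont_funs" using S unfolding \<A>_def by blast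
    have "cont_funs \<subseteq> sw_entourage B \<epsilon> `` S"
    proof (rule ccontr)
      assume "\<not> ?thesis"
      then obtain f where f: "f \<in> cont_funs" "\<forall>s\<in>S. (s, f) \<notin> sw_entourage B \<epsilon>" by blast
      then have "insert f S \<in> \<A>" using S sw_entourage_sym unfolding \<A>_def by blast
      then have "f \<in> S" using max by blast
      then show False using f sw_entourage_refl[OF f(1) B(2)] by blast
    qed
    moreover have "|S| \<le>o top_cellularity ?T"
    proof -
      let ?n = "\<lambda>s. sw_entourage B ?h `` {s}"
      have disj: "?n s \<inter> ?n t = {}" if "s \<in> S" "t \<in> S" "s \<noteq> t" for s t
      proof (rule ccontr)
        assume "?n s \<inter> ?n t \<noteq> {}"
        then obtain g where "(s, g) \<in> sw_entourage B ?h" "(g, t) \<in> sw_entourage B ?h"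
          using sw_entourage_sym by blast
        then have "(s, t) \<in> sw_entourage B \<epsilon>" by (rule sw_entourage_trans) simp
        then show False using S that unfolding \<A>_def by blast
      qed
      have self: "s \<in> ?n s" if "s \<in> S" for s
        using sw_entourage_refl[OF _ half_pos_cont_funs[OF B(2)]] Sc that by blast
      have "inj_on ?n S"
      proof (rule inj_onI, rule ccontr)
        fix s t assume "s \<in> S" "t \<in> S" "?n s = ?n t" "s \<noteq> t"
        then show False using disj[of s t] self[of s] by blast
      qed
      then have "|S| \<le>o |?n ` S|" by (intro card_of_ordLeqI[of ?n]) auto
      moreover have "?n ` S \<in> ?D"
        using openin_sw_entourage_Image[OF \<B> B(1) half_pos_cont_funs[OF B(2)]] disj
        unfolding pairwise_def disjnt_def by blast
      ultimately show ?thesis using cell ordLeq_transitive by blast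
    qed
    ultimately show "\<exists>S\<subseteq>cont_funs. |S| \<le>o top_cellularity ?T \<and> cont_funs \<subseteq> sw_entourage B \<epsilon> `` S"
      using Sc by blast
  qed
qed

section \<open>The weight of the bornology\<close>

text \<open>
  Choose a closed base, and for each basic neighbourhood \<open>N\<close> of \<open>0\<close> a member \<open>b N\<close> of it with
  \<open>[b N, \<epsilon>](0) \<subseteq> N\<close>. If \<open>N \<subseteq> [C, 1](0)\<close>, then \<open>C \<subseteq> b N\<close>: otherwise a function vanishing near \<open>b N\<close>
  and equal to \<open>1\<close> at some point of \<open>C\<close> would lie in \<open>[b N, \<epsilon>](0)\<close> but not in \<open>[C, 1](0)\<close>. Closedness
  is what separates that point from \<open>b N\<close>.
\<close>

lemma bornology_weight_le_weight:
  fixes \<B> :: "'a::metric_space set set"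
  assumes \<B>: "bornology \<B>" and cb: "has_closed_base \<B>"
  shows "bornology_weight \<B> \<le>o top_weight (sw_topology \<B>)"
proof -
  let ?T = "sw_topology \<B>"
  have zero: "0 \<in> cont_funs" unfolding cont_funs_def by (simp add: zero_fun_def)
  obtain \<B>\<^sub>0 where \<B>\<^sub>0: "bornology_base \<B> \<B>\<^sub>0" "\<forall>B\<in>\<B>\<^sub>0. closed B"
    using cb unfolding has_closed_base_def by blast
  obtain \<N> where \<N>: "is_topology_base ?T \<N>" "|\<N>| \<le>o top_weight ?T"
    by (rule obtain_topology_base)
  have "\<exists>B. B \<in> \<B>\<^sub>0 \<and> (\<exists>\<epsilon>\<in>pos_cont_funs. sw_entourage B \<epsilon> `` {0} \<subseteq> N)"
    if N: "N \<in> \<N>" "0 \<in> N" for N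
  proof -
    have "openin ?T N" using \<N>(1) N unfolding is_topology_base_def by blast
    then obtain B \<epsilon> where "B \<in> \<B>" "\<epsilon> \<in> pos_cont_funs" "sw_entourage B \<epsilon> `` {0} \<subseteq> N"
      using N unfolding openin_sw_topology_iff[OF \<B>] by blast
    moreover then obtain B' where "B' \<in> \<B>\<^sub>0" "B \<subseteq> B'"
      using \<B>\<^sub>0(1) unfolding bornology_base_def by blast
    ultimately show ?thesis using sw_entourage_mono[of B B' \<epsilon>] by blast
  qed
  then obtain b where b: "\<And>N. N \<in> \<N> \<Longrightarrow> 0 \<in> N \<Longrightarrow>
      b N \<in> \<B>\<^sub>0 \<and> (\<exists>\<epsilon>\<in>pos_cont_funs. sw_entourage (b N) \<epsilon> `` {0} \<subseteq> N)"
    by metis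
  let ?B = "b ` {N \<in> \<N>. 0 \<in> N}"
  have cover: "\<exists>B'\<in>?B. C \<subseteq> B'" if C: "C \<in> \<B>" for C
  proof -
    have one: "(\<lambda>x. 1) \<in> pos_cont_funs" unfolding pos_cont_funs_def by simp
    have "0 \<in> sw_entourage C (\<lambda>x. 1) `` {0}" using sw_entourage_refl[OF zero one] by blast
    with openin_sw_entourage_Image[OF \<B> C one] obtain N where
      N: "N \<in> \<N>" "0 \<in> N" "N \<subseteq> sw_entourage C (\<lambda>x. 1) `` {0}"
      using \<N>(1)[unfolded is_topology_base_def, THEN conjunct2, rule_format, OF conjI] by blast
    obtain \<epsilon> where bN: "b N \<in> \<B>\<^sub>0" and \<epsilon>: "\<epsilon> \<in> pos_cont_funs"
        and sub: "sw_entourage (b N) \<epsilon> `` {0} \<subseteq> N"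
      using b N by blast
    have "b N \<in> \<B>" using bN \<B>\<^sub>0(1) unfolding bornology_base_def by blast
    then have ne: "b N \<noteq> {}" using \<B> unfolding bornology_def by metis
    have "C \<subseteq> b N"
    proof
      fix x assume x: "x \<in> C"
      show "x \<in> b N"
      proof (rule ccontr)
        assume "x \<notin> b N"
        moreover have "closed (b N)" using \<B>\<^sub>0(2) bN by (rule bspec)
        ultimately have pos: "0 < infdist x (b N)" using infdist_pos_not_in_closed ne by metis
        define \<rho> where "\<rho> = infdist x (b N)"
        have \<rho>: "0 < \<rho>" "0 < \<rho> / 2" using pos unfolding \<rho>_def by simp_all
        \<comment> \<open>zero at distance up to \<open>\<rho> / 2\<close> from \<open>b N\<close>, and one at \<open>x\<close>\<close>
        define f where "f y = max 0 (2 * infdist y (b N) / \<rho> - 1)" for y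
        have f: "f \<in> cont_funs"
          unfolding f_def[abs_def] cont_funs_def using \<rho> by (auto intro!: continuous_intros)
        have "\<forall>y\<in>enlargement (b N) (\<rho> / 2). \<bar>0 y - f y\<bar> < \<epsilon> y"
          unfolding enlargement_eq_infdist[OF ne] f_def
          using \<epsilon> \<rho> unfolding pos_cont_funs_def by (auto simp: field_simps)
        then have "(0, f) \<in> sw_entourage (b N) \<epsilon>"
          using zero f \<rho>(2) unfolding sw_entourage_def by blast
        then have "(0, f) \<in> sw_entourage C (\<lambda>x. 1)" using sub N(3) by blast
        then have "\<bar>0 x - f x\<bar> < 1" using x unfolding sw_entourage_def enlargement_def by auto
        then show False using \<rho> unfolding f_def by (simp add: \<rho>_def)
      qed
    qed
    then show ?thesis using N by blast
  qed
  have "\<B>\<^sub>0 \<subseteq> \<B>" using \<B>\<^sub>0(1) unfolding bornology_base_def by simp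
  then have "?B \<subseteq> \<B>" using b by auto
  with cover have "bornology_base \<B> ?B" unfolding bornology_base_def by simp
  moreover have "|?B| \<le>o top_weight ?T"
  proof -
    have "|?B| \<le>o |{N \<in> \<N>. 0 \<in> N}|" by (rule card_of_image)
    also have "|{N \<in> \<N>. 0 \<in> N}| \<le>o |\<N>|" by (rule card_of_mono1) blast
    also have "|\<N>| \<le>o top_weight ?T" by (rule \<N>(2))
    finally show ?thesis .
  qed
  moreover have "Cinfinite (top_weight ?T)"
    unfolding top_weight_def by (rule Cinfinite_natLeq_csum)
  ultimately show ?thesis
    unfolding bornology_weight_def by (intro natLeq_csum_min_card_le[of ?B]) auto
qed

text \<open>
  The entourages \<open>[B, 1/(\<bar>s\<bar> + 1)]\<close> refine all entourages when \<open>B\<close> runs through a base of the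
  bornology and \<open>s\<close> through a set of centres for \<open>[B, 1]\<close>: the continuous function \<open>2/\<epsilon>\<close> lies within \<open>1\<close>
  of some \<open>s\<close> near \<open>B\<close>, so \<open>1/(\<bar>s\<bar> + 1) \<le> \<epsilon>/2\<close> there. The balls of these entourages around
  corresponding centres are a base, by the triangle inequality.
\<close>

lemma weight_le_bornology_weight_narrowness_index:
  fixes \<B> :: "'a::metric_space set set"
  assumes \<B>: "bornology \<B>"
  shows "top_weight (sw_topology \<B>) \<le>o bornology_weight \<B> *c narrowness_index (sw_topology \<B>)"
proof -
  let ?T = "sw_topology \<B>"
  let ?i = "narrowness_index ?T"
  let ?r = "bornology_weight \<B> *c ?i"
  have Cw: "Cinfinite (bornology_weight \<B>)"
    unfolding bornology_weight_def by (rule Cinfinite_natLeq_csum)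
  have Ci: "Cinfinite ?i" unfolding narrowness_index_def by (rule Cinfinite_natLeq_csum)
  have Cr: "Cinfinite ?r" using Cinfinite_cprod2[OF Cinfinite_Cnotzero[OF Cw] Ci] .
  have wr: "bornology_weight \<B> \<le>o ?r"
    using ordLeq_ordIso_trans[OF ordLeq_cprod2[OF Cinfinite_Cnotzero[OF Ci]] cprod_com] Cw
    by blast
  have ir: "?i \<le>o ?r" using Cw Ci by (simp add: ordLeq_cprod2 Cinfinite_Cnotzero)
  have "bornology_base \<B> \<B>" unfolding bornology_base_def by blast
  then have "{\<B>\<^sub>0. bornology_base \<B> \<B>\<^sub>0} \<noteq> {}" by blast
  from min_card_attained[OF this] obtain \<B>\<^sub>0 where
    \<B>\<^sub>0: "bornology_base \<B> \<B>\<^sub>0" "|\<B>\<^sub>0| \<le>o bornology_weight \<B>"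
    unfolding bornology_weight_def by blast
  obtain S where S: "\<And>B \<epsilon>. B \<in> \<B> \<Longrightarrow> \<epsilon> \<in> pos_cont_funs \<Longrightarrow>
      S B \<epsilon> \<subseteq> cont_funs \<and> |S B \<epsilon>| \<le>o ?i \<and> cont_funs \<subseteq> sw_entourage B \<epsilon> `` S B \<epsilon>"
    using narrow_narrowness_index[OF \<B>] unfolding narrow_sw_topology_iff[OF \<B>] by metis
  define q where "q s x = 1 / (\<bar>s x\<bar> + 1)" for s :: "'a \<Rightarrow> real" and x
  have q: "q s \<in> pos_cont_funs" if "s \<in> cont_funs" for s
    using that unfolding q_def[abs_def] pos_cont_funs_def cont_funs_def
    by (auto intro!: continuous_intros simp: add_nonneg_eq_0_iff)
  have one: "(\<lambda>x. 1) \<in> pos_cont_funs" unfolding pos_cont_funs_def by simp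
  define \<N> where "\<N> = (\<Union>B\<in>\<B>\<^sub>0. \<Union>s\<in>S B (\<lambda>x. 1).
      (\<lambda>f. sw_entourage B (q s) `` {f}) ` S B (q s))"
  have \<B>\<^sub>0sub: "B \<in> \<B>" if "B \<in> \<B>\<^sub>0" for B using that \<B>\<^sub>0(1) unfolding bornology_base_def by blast
  have "is_topology_base ?T \<N>"
    unfolding is_topology_base_def
  proof (intro conjI ballI allI impI)
    fix V assume "V \<in> \<N>"
    then obtain B s f where "B \<in> \<B>\<^sub>0" "s \<in> S B (\<lambda>x. 1)" "V = sw_entourage B (q s) `` {f}"
      unfolding \<N>_def by blast
    moreover then have "B \<in> \<B>" "s \<in> cont_funs" using \<B>\<^sub>0sub S[OF _ one] by blast+
    ultimately show "openin ?T V" using openin_sw_entourage_Image[OF \<B>] q by blast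
  next
    fix U g assume Ug: "openin ?T U \<and> g \<in> U"
    then obtain A \<epsilon> where A: "A \<in> \<B>" and \<epsilon>: "\<epsilon> \<in> pos_cont_funs"
        and AU: "sw_entourage A \<epsilon> `` {g} \<subseteq> U" and g: "g \<in> cont_funs"
      unfolding openin_sw_topology_iff[OF \<B>] by blast
    obtain B where B: "B \<in> \<B>\<^sub>0" "A \<subseteq> B" using A \<B>\<^sub>0(1) unfolding bornology_base_def by blast
    note B\<B> = \<B>\<^sub>0sub[OF B(1)]
    have eps: "0 < \<epsilon> x" for x using \<epsilon> unfolding pos_cont_funs_def by simp
    \<comment> \<open>the factor 2 leaves room for the triangle inequality below\<close>
    have "(\<lambda>x. 2 / \<epsilon> x) \<in> cont_funs"
      using \<epsilon> unfolding cont_funs_def pos_cont_funs_def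
      by (auto intro!: continuous_intros simp: less_imp_neq[symmetric])
    then obtain s where s: "s \<in> S B (\<lambda>x. 1)" "(s, \<lambda>x. 2 / \<epsilon> x) \<in> sw_entourage B (\<lambda>x. 1)"
      using S[OF B\<B> one] by blast
    obtain \<delta> where \<delta>: "\<delta> > 0" "\<forall>x\<in>enlargement B \<delta>. \<bar>s x - 2 / \<epsilon> x\<bar> < 1"
      using s(2) unfolding sw_entourage_def by blast
    have sc: "s \<in> cont_funs" using S[OF B\<B> one] s(1) by blast
    have small: "q s x \<le> \<epsilon> x / 2" if "x \<in> enlargement B \<delta>" for x
    proof -
      have "2 / \<epsilon> x \<le> \<bar>s x\<bar> + 1" using \<delta>(2) that by fastforce
      then show ?thesis unfolding q_def using eps[of x] by (simp add: field_simps)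
    qed
    have ent: "(u, v) \<in> sw_entourage B (\<lambda>x. \<epsilon> x / 2)" if uv: "(u, v) \<in> sw_entourage B (q s)" for u v
    proof -
      obtain \<eta> where \<eta>: "\<eta> > 0" "\<forall>x\<in>enlargement B \<eta>. \<bar>u x - v x\<bar> < q s x"
        using uv unfolding sw_entourage_def by blast
      have "\<bar>u x - v x\<bar> < \<epsilon> x / 2" if "x \<in> enlargement B (min \<delta> \<eta>)" for x
      proof -
        have "x \<in> enlargement B \<delta>" "x \<in> enlargement B \<eta>"
          using that unfolding enlargement_def by auto
        then show ?thesis using small[of x] \<eta>(2) by fastforce
      qed
      then show ?thesis
        using uv \<delta>(1) \<eta>(1) unfolding sw_entourage_def by (auto intro!: exI[of _ "min \<delta> \<eta>"])
    qed
    obtain f where f: "f \<in> S B (q s)" "(f, g) \<in> sw_entourage B (q s)"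
      using S[OF B\<B> q[OF sc]] g by blast
    have "sw_entourage B (q s) `` {f} \<subseteq> U"
    proof
      fix h assume "h \<in> sw_entourage B (q s) `` {f}"
      then have "(g, h) \<in> sw_entourage B \<epsilon>"
        using sw_entourage_trans[OF ent[OF sw_entourage_sym[OF f(2)]] ent[of f h], of \<epsilon>] by simp
      then show "h \<in> U" using AU sw_entourage_mono[OF B(2)] by blast
    qed
    moreover have "sw_entourage B (q s) `` {f} \<in> \<N>" unfolding \<N>_def using B(1) s(1) f(1) by blast
    ultimately show "\<exists>V\<in>\<N>. g \<in> V \<and> V \<subseteq> U" using f(2) by blast
  qed
  moreover have "|\<N>| \<le>o ?r"
    unfolding \<N>_def
  proof (intro UNION_Cinfinite_bound[OF _ _ Cr] ballI)
    show "|\<B>\<^sub>0| \<le>o ?r" by (rule ordLeq_transitive[OF \<B>\<^sub>0(2) wr])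
  next
    fix B assume "B \<in> \<B>\<^sub>0"
    then have "|S B (\<lambda>x. 1)| \<le>o ?i" using S[OF \<B>\<^sub>0sub one] by simp
    then show "|S B (\<lambda>x. 1)| \<le>o ?r" by (rule ordLeq_transitive[OF _ ir])
  next
    fix B s assume B: "B \<in> \<B>\<^sub>0" and s: "s \<in> S B (\<lambda>x. 1)"
    then have "s \<in> cont_funs" using S[OF \<B>\<^sub>0sub[OF B] one] by auto
    then have "|S B (q s)| \<le>o ?i" using S[OF \<B>\<^sub>0sub[OF B] q] by simp
    then have "|S B (q s)| \<le>o ?r" by (rule ordLeq_transitive[OF _ ir])
    then show "|(\<lambda>f. sw_entourage B (q s) `` {f}) ` S B (q s)| \<le>o ?r"
      by (rule ordLeq_transitive[OF card_of_image])
  qed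
  ultimately show ?thesis
    unfolding top_weight_def using Cr by (intro natLeq_csum_min_card_le[of \<N>]) auto
qed

theorem theorem4p15:
  fixes \<B> :: "'a::metric_space set set"
  assumes "\<exists>x y :: 'a. x \<noteq> y"
    and "bornology \<B>"
    and "has_closed_base \<B>"
  defines "T \<equiv> sw_topology \<B>"
  shows "top_weight T =o bornology_weight \<B> *c narrowness_index T \<and>
         bornology_weight \<B> *c narrowness_index T =o bornology_weight \<B> *c top_cellularity T \<and>
         bornology_weight \<B> *c top_cellularity T =o bornology_weight \<B> *c lindelof_degree T \<and>
         bornology_weight \<B> *c lindelof_degree T =o bornology_weight \<B> *c top_density T \<and>
         bornology_weight \<B> *c top_density T =o bornology_weight \<B> *c network_weight T"
proof -
  note \<B> = assms(2)
  have inf: "Cinfinite (top_weight T)" "Cinfinite (narrowness_index T)"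
    unfolding top_weight_def narrowness_index_def
    by (rule Cinfinite_natLeq_csum)+
  have i: "narrowness_index T \<le>o top_cellularity T" "narrowness_index T \<le>o lindelof_degree T"
      "narrowness_index T \<le>o top_density T"
    unfolding T_def
    by (rule narrowness_index_le_cellularity[OF \<B>] narrowness_index_le_lindelof_degree[OF \<B>]
        narrowness_index_le_density[OF \<B>])+
  have i_nw: "narrowness_index T \<le>o network_weight T"
    by (rule ordLeq_transitive[OF i(3) density_le_network_weight])
  have d_w: "top_density T \<le>o top_weight T"
    by (rule ordLeq_transitive[OF density_le_network_weight network_weight_le_weight])
  have i_w: "narrowness_index T \<le>o top_weight T" by (rule ordLeq_transitive[OF i(3) d_w])
  have i_i: "narrowness_index T \<le>o narrowness_index T" using inf(2) by (simp add: ordLeq_refl)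
  note squeeze = cprod_squeeze[OF inf(1)
      weight_le_bornology_weight_narrowness_index[OF \<B>, folded T_def]
      bornology_weight_le_weight[OF \<B> assms(3), folded T_def]]
  have eq: "bornology_weight \<B> *c narrowness_index T =o top_weight T"
    "bornology_weight \<B> *c top_cellularity T =o top_weight T"
    "bornology_weight \<B> *c lindelof_degree T =o top_weight T"
    "bornology_weight \<B> *c top_density T =o top_weight T"
    "bornology_weight \<B> *c network_weight T =o top_weight T"
    using squeeze[OF i_i i_w] squeeze[OF i(1) cellularity_le_weight]
      squeeze[OF i(2) lindelof_degree_le_weight] squeeze[OF i(3) d_w]
      squeeze[OF i_nw network_weight_le_weight] .
  show ?thesis
    by (intro conjI ordIso_symmetric[OF eq(1)] ordIso_transitive[OF eq(1) ordIso_symmetric[OF eq(2)]]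
        ordIso_transitive[OF eq(2) ordIso_symmetric[OF eq(3)]]
        ordIso_transitive[OF eq(3) ordIso_symmetric[OF eq(4)]]
        ordIso_transitive[OF eq(4) ordIso_symmetric[OF eq(5)]])
qed

end
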